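(* Let $\mathcal{M}_0 \subseteq \mathcal{M}_1$ be nested exposure models on $n$ units, defined by collections of exposure mappings $\boldsymbol{h}_0=(h_1^0,\dots,h_n^0)$ and $\boldsymbol{h}_1=(h_1^1,\dots,h_n^1)$ respectively, and let $\delta\ge 0$ be any non-trivial separation value, i.e. $\mathcal{M}_1(\delta)\neq\emptyset$. Then the specification testing problem corresponding to the null exposure model $\mathcal{M}_0$ and the alternative exposure model $\mathcal{M}_1(\delta)$ is impossible: the minimax testing error satisfies $\mathcal{R}^*(\delta)=1$.
   Context: **Experiment.** There are $n$ units. Interventions form a measurable space $(\Omega,\mathcal{F})$ (for instance $\Omega=\{0,1\}^n$ with all subsets). An experimental design $\mathcal{D}$ is a probability measure on $(\Omega,\mathcal{F})$. A potential outcome function is a measurable function $\boldsymbol{y}=(y_1,\dots,y_n):\Omega\to\mathbb{R}^n$, and $\|\boldsymbol{y}\|_\infty=\max_{i\in[n]}\sup_{\boldsymbol{z}\in\Omega}|y_i(\boldsymbol{z})|$. **Exposure models.** For each unit $i$, an exposure mapping is a (measurable) function $h_i:\Omega\to\Delta_i$ into a finite set $\Delta_i$ of exposures. The exposure model of the collection $\boldsymbol{h}=(h_1,\dots,h_n)$ is the set of potential outcome functions $\boldsymbol{y}$ with $\|\boldsymbol{y}\|_\infty\le 1$ such that $y_i(\boldsymbol{z})=y_i(\boldsymbol{z}')$ for all $i\in[n]$ and all $\boldsymbol{z},\boldsymbol{z}'\in\Omega$ with $h_i(\boldsymbol{z})=h_i(\boldsymbol{z}')$. The null model $\mathcal{M}_0$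 is the exposure model of mappings $h_i^0:\Omega\to\Delta_i^0$ and the alternative model $\mathcal{M}_1$ is the exposure model of mappings $h_i^1:\Omega\to\Delta_i^1$, with $\mathcal{M}_0\subseteq\mathcal{M}_1$. **Separation.** For $\boldsymbol{y}\in\mathcal{M}_1$, $$g(\boldsymbol{y})=\frac1n\sum_{i=1}^n\sum_{e\in\Delta_i^0}\sup\left\{\left(y_i(\boldsymbol{z})-y_i(\boldsymbol{z}')\right)^2:\boldsymbol{z},\boldsymbol{z}'\in\Omega,\ h_i^0(\boldsymbol{z})=h_i^0(\boldsymbol{z}')=e\right\}$$ (the supremum over an empty set is read as $0$). The $\delta$-separated alternative is $\mathcal{M}_1(\delta)=\{\boldsymbol{y}\in\mathcal{M}_1:g(\boldsymbol{y})\ge\delta\}$. A value $\delta$ is trivial if $\mathcal{M}_1(\delta)=\emptyset$ and non-trivial otherwise. **Testing.** A statistical test is a measurable function $\phi:\Omega\times\mathbb{R}^n\to\{0,1\}$. The overall testing error of a pair $(\mathcal{D},\phi)$ is $$\mathcal{R}(\mathcal{D},\phi,\delta)=\sup_{\boldsymbol{y}\in\mathcal{M}_0}\mathrm{E}_{\boldsymbol{z}\sim\mathcal{D}}[\phi(\boldsymbol{z},\boldsymbol{y}(\boldsymbol{z}))]+\sup_{\boldsymbol{y}\in\mathcal{M}_1(\delta)}\mathrm{E}_{\boldsymbol{z}\sim\mathcal{D}}[1-\phi(\boldsymbol{z},\boldsymbol{y}(\boldsymbol{z}))],$$ and the minimax testing error is $\mathcal{R}^*(\delta)=\inf_{\mathcal{D},\phi}\mathcal{R}(\mathcal{D},\phi,\delta)$,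 the infimum being over all designs and all tests. The testing problem is called impossible at separation $\delta$ if $\mathcal{R}^*(\delta)=1$. *)

theory Defs
  imports "HOL-Probability.Probability"
begin

text \<open>
  The interventions form the measurable space \<open>(space M, sets M)\<close>; only the underlying
  \<open>\<sigma>\<close>-algebra of \<open>M\<close> is used, never its measure. The units are the elements
  of a finite type \<open>'n\<close>, so \<open>n = CARD('n)\<close>. Potential outcome functions are total
  functions \<open>'z \<Rightarrow> real ^ 'n\<close>, but everything below depends only on their
  values on \<open>space M\<close>.
\<close>

text \<open>
  Extended-real valued, so that \<open>sup_norm M y \<le> 1\<close> really excludes unbounded functions.
\<close>
definition sup_norm :: "'z measure \<Rightarrow> ('z \<Rightarrow> real ^ 'n::finite) \<Rightarrow> ereal" where
  "sup_norm M y = (MAX i. SUP z\<in>space M. ereal \<bar>y z $ i\<bar>)"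

text \<open>
  The finite exposure sets \<open>\<Delta> i\<close> of the different units share one type; this is no
  restriction, as their disjoint union can be used. They carry the discrete
  \<open>\<sigma>\<close>-algebra.
\<close>
definition exposure_mappings ::
    "'z measure \<Rightarrow> ('n::finite \<Rightarrow> 'e set) \<Rightarrow> ('n \<Rightarrow> 'z \<Rightarrow> 'e) \<Rightarrow> bool" where
  "exposure_mappings M \<Delta> h \<longleftrightarrow>
     (\<forall>i. finite (\<Delta> i) \<and> h i \<in> M \<rightarrow>\<^sub>M count_space (\<Delta> i))"

definition exposure_model ::
    "'z measure \<Rightarrow> ('n::finite \<Rightarrow> 'z \<Rightarrow> 'e) \<Rightarrow> ('z \<Rightarrow> real ^ 'n) set" where
  "exposure_model M h =
     {y \<in> borel_measurable M. sup_norm M y \<le> 1 \<and>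
        (\<forall>i. \<forall>z\<in>space M. \<forall>z'\<in>space M. h i z = h i z' \<longrightarrow> y z $ i = y z' $ i)}"

text \<open>
  Supremum of a set of nonnegative reals with the convention that the empty set has supremum
  \<open>0\<close> (the library leaves \<open>Sup {} :: real\<close> unspecified).
\<close>
definition Sup0 :: "real set \<Rightarrow> real" where
  "Sup0 A = (if A = {} then 0 else Sup A)"

text \<open>
  Intended for \<open>y\<close> with \<open>sup_norm M y \<le> 1\<close>, where the sets below are bounded by
  \<open>4\<close>.
\<close>
definition separation ::
    "'z measure \<Rightarrow> ('n::finite \<Rightarrow> 'e set) \<Rightarrow> ('n \<Rightarrow> 'z \<Rightarrow> 'e) \<Rightarrow> ('z \<Rightarrow> real ^ 'n) \<Rightarrow> real" where
  "separation M \<Delta>0 h0 y =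
     1 / real CARD('n) *
       (\<Sum>i\<in>UNIV. \<Sum>e\<in>\<Delta>0 i.
          Sup0 {(y z $ i - y z' $ i)\<^sup>2 | z z'.
                  z \<in> space M \<and> z' \<in> space M \<and> h0 i z = e \<and> h0 i z' = e})"

definition separated_alternative ::
    "'z measure \<Rightarrow> ('n::finite \<Rightarrow> 'e set) \<Rightarrow> ('n \<Rightarrow> 'z \<Rightarrow> 'e) \<Rightarrow> ('n \<Rightarrow> 'z \<Rightarrow> 'f) \<Rightarrow> real
       \<Rightarrow> ('z \<Rightarrow> real ^ 'n) set" where
  "separated_alternative M \<Delta>0 h0 h1 \<delta> =
     {y \<in> exposure_model M h1. separation M \<Delta>0 h0 y \<ge> \<delta>}"

definition designs :: "'z measure \<Rightarrow> 'z measure set" where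
  "designs M = {D. prob_space D \<and> sets D = sets M}"

definition tests :: "'z measure \<Rightarrow> ('z \<times> (real ^ 'n::finite) \<Rightarrow> real) set" where
  "tests M = (M \<Otimes>\<^sub>M borel) \<rightarrow>\<^sub>M count_space {0, 1}"

text \<open>
  For a design, a test and nonempty sets \<open>\<M>0\<close>, \<open>\<M>A\<close> of potential outcome functions,
  both suprema range over nonempty subsets of \<open>{0..1}\<close>, so the real-valued
  \<open>SUP\<close> here and \<open>INF\<close> in the minimax error are the genuine ones
  (provided there is a design at all, i.e. \<open>space M \<noteq> {}\<close>).
\<close>
definition testing_error ::
    "('z \<Rightarrow> real ^ 'n::finite) set \<Rightarrow> ('z \<Rightarrow> real ^ 'n) set
       \<Rightarrow> 'z measure \<Rightarrow> ('z \<times> (real ^ 'n) \<Rightarrow> real) \<Rightarrow> real" where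
  "testing_error \<M>0 \<M>A D \<phi> =
     (SUP y\<in>\<M>0. \<integral>z. \<phi> (z, y z) \<partial>D) + (SUP y\<in>\<M>A. \<integral>z. (1 - \<phi> (z, y z)) \<partial>D)"

definition minimax_testing_error ::
    "'z measure \<Rightarrow> ('z \<Rightarrow> real ^ 'n::finite) set \<Rightarrow> ('z \<Rightarrow> real ^ 'n) set \<Rightarrow> real" where
  "minimax_testing_error M \<M>0 \<M>A =
     (INF (D, \<phi>)\<in>designs M \<times> tests M. testing_error \<M>0 \<M>A D \<phi>)"

definition testing_impossible ::
    "'z measure \<Rightarrow> ('z \<Rightarrow> real ^ 'n::finite) set \<Rightarrow> ('z \<Rightarrow> real ^ 'n) set \<Rightarrow> bool" where
  "testing_impossible M \<M>0 \<M>A \<longleftrightarrow> minimax_testing_error M \<M>0 \<M>A = 1"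

end

theory Submission
  imports Defs
begin

text \<open>
  A single experiment reveals \<open>y\<close> at one intervention only. Enlarge an alternative to
  one with values in \<open>{-1, 1}\<close> whose restriction to every level set of
  \<open>h0 i\<close> has the largest oscillation that \<open>h1 i\<close> permits, and multiply it
  coordinatewise by a uniformly random vector of signs: the separation is unchanged, while the
  outcome at each fixed intervention becomes a uniformly random sign vector. The same law is
  produced by a uniformly random constant function, which belongs to the null model, so no test
  can do better than the constant one.
\<close>

section \<open>Bounds on outcomes and suprema\<close>

lemma sup_norm_le_iff:
  fixes y :: "'z \<Rightarrow> real ^ 'n::finite"
  shows "sup_norm M y \<le> ereal c \<longleftrightarrow> (\<forall>i. \<forall>z\<in>space M. \<bar>y z $ i\<bar> \<le> c)"
  unfolding sup_norm_def by (subst Max_le_iff) (auto simp: SUP_le_iff)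

lemma Sup0_le: "(\<And>x. x \<in> A \<Longrightarrow> x \<le> c) \<Longrightarrow> 0 \<le> c \<Longrightarrow> Sup0 A \<le> c"
  unfolding Sup0_def by (auto intro: cSup_least)

lemma Sup0_upper: "x \<in> A \<Longrightarrow> bdd_above A \<Longrightarrow> x \<le> Sup0 A"
  unfolding Sup0_def by (auto intro: cSup_upper)

lemma Sup0_nonneg: "(\<And>x. x \<in> A \<Longrightarrow> 0 \<le> x) \<Longrightarrow> bdd_above A \<Longrightarrow> 0 \<le> Sup0 A"
  by (cases "A = {}") (auto simp: Sup0_def intro: cSup_upper2)

lemma square_diff_le_4:
  fixes a b :: real
  assumes "\<bar>a\<bar> \<le> 1" "\<bar>b\<bar> \<le> 1"
  shows "(a - b)\<^sup>2 \<le> 4"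
proof -
  have "\<bar>a - b\<bar>\<^sup>2 \<le> 2\<^sup>2"
    using assms by (intro power_mono) auto
  then show ?thesis
    by simp
qed

lemma bdd_above_square_diff:
  fixes f :: "'z \<Rightarrow> real"
  assumes "\<And>z. z \<in> A \<Longrightarrow> \<bar>f z\<bar> \<le> 1"
  shows "bdd_above {(f z - f z')\<^sup>2 | z z'. z \<in> A \<and> z' \<in> A \<and> P z \<and> P z'}"
  by (rule bdd_aboveI[of _ 4]) (auto intro!: square_diff_le_4 assms)

section \<open>Designs, tests and the testing error\<close>

lemma designs_nonempty: "space M \<noteq> {} \<Longrightarrow> designs M \<noteq> {}"
  using prob_space_return[of _ M] sets_return[of M] unfolding designs_def by blast

lemma test_outcome_measurable:
  assumes "\<phi> \<in> tests M" "y \<in> borel_measurable M" "D \<in> designs M"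
  shows "(\<lambda>z. \<phi> (z, y z)) \<in> borel_measurable D"
proof -
  have [measurable]: "\<phi> \<in> M \<Otimes>\<^sub>M borel \<rightarrow>\<^sub>M count_space {0, 1}" "y \<in> borel_measurable M"
    using assms by (auto simp: tests_def)
  have "(\<lambda>x. x :: real) \<in> count_space {0, 1} \<rightarrow>\<^sub>M borel"
    by simp
  then have "(\<lambda>z. \<phi> (z, y z)) \<in> borel_measurable M"
    by (rule measurable_compose[rotated]) measurable
  then show ?thesis
    using assms(3) by (simp add: designs_def cong: measurable_cong_sets)
qed

lemma test_range:
  assumes "\<phi> \<in> tests M" "z \<in> space M"
  shows "\<phi> (z, x) = 0 \<or> \<phi> (z, x) = 1"
  using measurable_space[OF assms(1)[unfolded tests_def], of "(z, x)"] assms(2)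
  by (auto simp: space_pair_measure)

lemma test_outcome_integrable:
  assumes "\<phi> \<in> tests M" "y \<in> borel_measurable M" "D \<in> designs M"
  shows "integrable D (\<lambda>z. \<phi> (z, y z))"
proof -
  have D: "prob_space D" "space D = space M"
    using assms(3) sets_eq_imp_space_eq[of D M] by (auto simp: designs_def)
  interpret prob_space D by fact
  have "norm (\<phi> (z, y z)) \<le> 1" if "z \<in> space D" for z
    using test_range[OF assms(1), of z "y z"] that D(2) by auto
  then show ?thesis
    using test_outcome_measurable[OF assms] by (intro integrable_const_bound[of _ 1] AE_I2)
qed

text \<open>If a mixture of null functions and a mixture of alternatives give the same law of
  outcomes at every intervention, the two average error probabilities add up to exactly 1, and each
  supremum is at least its average. Since \<open>mix\<close> holds pointwise in \<open>z\<close>,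
  the design is irrelevant.\<close>

lemma testing_error_ge_1:
  fixes \<M>0 \<M>A :: "('z \<Rightarrow> real ^ 'n::finite) set"
  assumes D: "D \<in> designs M" and \<phi>: "\<phi> \<in> tests M"
    and "\<M>0 \<subseteq> borel_measurable M" "\<M>A \<subseteq> borel_measurable M"
    and "finite I" "I \<noteq> {}" and u: "\<And>k. k \<in> I \<Longrightarrow> u k \<in> \<M>0" and v: "\<And>k. k \<in> I \<Longrightarrow> v k \<in> \<M>A"
    and mix: "\<And>(f :: real ^ 'n \<Rightarrow> real) z. z \<in> space M \<Longrightarrow> (\<Sum>k\<in>I. f (u k z)) = (\<Sum>k\<in>I. f (v k z))"
  shows "1 \<le> testing_error \<M>0 \<M>A D \<phi>"
proof -
  have "prob_space D" and sp: "space D = space M"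
    using D sets_eq_imp_space_eq[of D M] by (auto simp: designs_def)
  interpret prob_space D by fact
  let ?a = "\<lambda>y. \<integral>z. \<phi> (z, y z) \<partial>D" and ?b = "\<lambda>y. \<integral>z. (1 - \<phi> (z, y z)) \<partial>D"
  have int: "integrable D (\<lambda>z. \<phi> (z, y z))" if "y \<in> borel_measurable M" for y
    using \<phi> that D by (rule test_outcome_integrable)
  have range: "0 \<le> \<phi> (z, x)" "\<phi> (z, x) \<le> 1" if "z \<in> space D" for z x
    using test_range[OF \<phi>, of z x] that sp by auto
  have b: "?b y = 1 - ?a y" if "y \<in> borel_measurable M" for y
    using int[OF that] by (simp add: prob_space)
  have a01: "0 \<le> ?a y" "?a y \<le> 1" if "y \<in> borel_measurable M" for y
    using range int[OF that] by (auto intro!: integral_nonneg_AE integral_le_const AE_I2)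
  \<comment> \<open>The real-valued \<open>SUP\<close> is known to dominate its members only once
    boundedness is established.\<close>
  have bdd: "bdd_above (?a ` \<M>0)" "bdd_above (?b ` \<M>A)"
    using assms(3,4) a01 by (fastforce intro!: bdd_aboveI2[where M = 1] simp del: Bochner_Integration.integral_diff simp: b)+
  have "(\<Sum>k\<in>I. ?a (u k)) = (\<integral>z. (\<Sum>k\<in>I. \<phi> (z, u k z)) \<partial>D)"
    using u assms(3) by (intro Bochner_Integration.integral_sum[symmetric] int) auto
  \<comment> \<open>Here \<open>mix\<close> is applied at fixed \<open>z\<close> to the function
    \<open>\<lambda>x. \<phi> (z, x)\<close>.\<close>
  also have "\<dots> = (\<integral>z. (\<Sum>k\<in>I. \<phi> (z, v k z)) \<partial>D)"
    by (intro Bochner_Integration.integral_cong refl mix) (simp add: sp)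
  also have "\<dots> = (\<Sum>k\<in>I. ?a (v k))"
    using v assms(4) by (intro Bochner_Integration.integral_sum int) auto
  also have "\<dots> = (\<Sum>k\<in>I. 1 - ?b (v k))"
  proof (rule sum.cong)
    fix k assume "k \<in> I"
    then show "?a (v k) = 1 - ?b (v k)"
      using b[of "v k"] v assms(4) by fastforce
  qed simp
  finally have eq: "(\<Sum>k\<in>I. ?a (u k) + ?b (v k)) = real (card I)"
    by (simp add: sum.distrib sum_subtractf)
  have "(\<Sum>k\<in>I. ?a (u k) + ?b (v k)) \<le> (\<Sum>k\<in>I. testing_error \<M>0 \<M>A D \<phi>)"
    unfolding testing_error_def
    by (intro sum_mono add_mono cSUP_upper u v bdd)
  then have "real (card I) * 1 \<le> real (card I) * testing_error \<M>0 \<M>A D \<phi>"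
    using eq by simp
  moreover have "0 < real (card I)"
    using assms(5,6) by (simp add: card_gt_0_iff)
  ultimately show ?thesis
    by (rule mult_left_le_imp_le)
qed

text \<open>The test that never rejects has error 0 on the null and 1 on the alternative under any
  design, so only the lower bound remains to be supplied.\<close>

lemma testing_impossibleI:
  fixes \<M>0 \<M>A :: "('z \<Rightarrow> real ^ 'n::finite) set"
  assumes "space M \<noteq> {}" "\<M>0 \<noteq> {}" "\<M>A \<noteq> {}"
    and ge: "\<And>D \<phi>. D \<in> designs M \<Longrightarrow> \<phi> \<in> tests M \<Longrightarrow> 1 \<le> testing_error \<M>0 \<M>A D \<phi>"
  shows "testing_impossible M \<M>0 \<M>A"
proof -
  obtain D where D: "D \<in> designs M"
    using designs_nonempty[OF assms(1)] by auto
  have 0: "(\<lambda>_. 0) \<in> tests M"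
    by (simp add: tests_def)
  have "prob_space D"
    using D by (simp add: designs_def)
  then have "testing_error \<M>0 \<M>A D (\<lambda>_. 0) = 1"
    using assms(2,3) by (simp add: testing_error_def prob_space.prob_space)
  moreover have "minimax_testing_error M \<M>0 \<M>A \<le> testing_error \<M>0 \<M>A D (\<lambda>_. 0)"
    unfolding minimax_testing_error_def
    \<comment> \<open>The bound \<open>ge\<close> also shows that the real-valued infimum is taken
      over a set bounded below.\<close>
    using D 0 ge by (intro cINF_lower2[where x = "(D, \<lambda>_. 0)"] bdd_belowI2[where m = 1]) auto
  moreover have "1 \<le> minimax_testing_error M \<M>0 \<M>A"
    unfolding minimax_testing_error_def
    using D 0 ge by (intro cINF_greatest) auto
  ultimately show ?thesis
    by (simp add: testing_impossible_def)
qed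

section \<open>Sign vectors, exposure models and separation\<close>

definition sign_vec :: "'n::finite set \<Rightarrow> real ^ 'n" where
  "sign_vec X = (\<chi> i. if i \<in> X then 1 else -1)"

lemma sign_vec_nth [simp]: "sign_vec X $ i = (if i \<in> X then 1 else -1)"
  by (simp add: sign_vec_def)

text \<open>With sign vectors encoded as subsets, \<open>sym_diff\<close> with \<open>W\<close> is,
  up to a global sign, coordinatewise multiplication by \<open>sign_vec W\<close>. It is an
  involution on subsets, so a uniformly random sign vector stays uniform.\<close>

lemma sum_sym_diff:
  fixes W :: "'n::finite set"
  shows "(\<Sum>X\<in>UNIV. f (sym_diff X W)) = (\<Sum>X\<in>UNIV. f X)"
  by (rule sum.reindex_bij_witness[of _ "\<lambda>X. sym_diff X W" "\<lambda>X. sym_diff X W"]) auto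

lemma exposure_measurable:
  assumes "exposure_mappings M \<Delta> h"
  shows "Measurable.pred M (\<lambda>z. h i z \<in> S)"
proof -
  have "h i \<in> M \<rightarrow>\<^sub>M count_space (\<Delta> i)"
    using assms by (simp add: exposure_mappings_def)
  then show ?thesis
    by (rule measurable_compose) simp
qed

lemma borel_measurable_vec_iff:
  fixes f :: "'z \<Rightarrow> real ^ 'n::finite"
  shows "f \<in> borel_measurable M \<longleftrightarrow> (\<forall>i. (\<lambda>z. f z $ i) \<in> borel_measurable M)"
  by (subst borel_measurable_euclidean_space) (auto simp: Basis_vec_def cart_eq_inner_axis)

text \<open>Coordinate \<open>i\<close> depends on \<open>z\<close> only through
  \<open>h i z\<close>. This one family covers the random constants (\<open>S i\<close> empty), the
  indicators of single level sets and the extremal alternatives.\<close>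

lemma sign_vec_in_exposure_model:
  assumes "exposure_mappings M \<Delta> h"
  shows "(\<lambda>z. sign_vec (sym_diff X {i. h i z \<in> S i})) \<in> exposure_model M h"
proof -
  have [measurable]: "Measurable.pred M (\<lambda>z. h i z \<in> S i)" for i
    using assms by (rule exposure_measurable)
  have "(\<lambda>z. sign_vec (sym_diff X {i. h i z \<in> S i})) \<in> borel_measurable M"
    unfolding borel_measurable_vec_iff by simp
  moreover have "sup_norm M (\<lambda>z. sign_vec (sym_diff X {i. h i z \<in> S i})) \<le> ereal 1"
    unfolding sup_norm_le_iff by auto
  ultimately show ?thesis
    by (auto simp: exposure_model_def one_ereal_def)
qed

text \<open>The signed indicator of a level set of \<open>h0 i\<close> lies in the null model, hence
  in the alternative one, so it cannot distinguish two points with the same \<open>h1 i\<close>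
  exposure.\<close>

lemma exposure_model_subset_imp_refines:
  assumes "exposure_mappings M \<Delta>0 h0" "exposure_model M h0 \<subseteq> exposure_model M h1"
    and "z \<in> space M" "z' \<in> space M" "h1 i z = h1 i z'"
  shows "h0 i z = h0 i z'"
proof -
  have "(\<lambda>x. sign_vec (sym_diff {} {j. h0 j x \<in> {h0 j z}})) \<in> exposure_model M h1"
    using sign_vec_in_exposure_model[OF assms(1), of "{}" "\<lambda>j. {h0 j z}"] assms(2) by blast
  then have "sign_vec (sym_diff {} {j. h0 j z \<in> {h0 j z}}) $ i =
      sign_vec (sym_diff {} {j. h0 j z' \<in> {h0 j z}}) $ i"
    using assms(3-5) unfolding exposure_model_def by blast
  then show ?thesis
    by (auto split: if_splits)
qed

text \<open>Outcomes in [-1, 1] have squared differences at most 4. So it suffices that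
  \<open>w\<close> attains 4 on every level set on which \<open>y\<close> is not constant; elsewhere
  \<open>y\<close> contributes 0.\<close>

lemma separation_mono:
  assumes y: "sup_norm M y \<le> 1" and w: "sup_norm M w \<le> 1"
    and split: "\<And>i z z'. z \<in> space M \<Longrightarrow> z' \<in> space M \<Longrightarrow> h i z = h i z' \<Longrightarrow> y z $ i \<noteq> y z' $ i \<Longrightarrow>
      \<exists>x\<in>space M. \<exists>x'\<in>space M. h i x = h i z \<and> h i x' = h i z \<and> (w x $ i - w x' $ i)\<^sup>2 = 4"
  shows "separation M \<Delta> h y \<le> separation M \<Delta> h w"
  unfolding separation_def
proof (intro mult_left_mono sum_mono)
  fix i e
  let ?A = "\<lambda>y. {(y z $ i - y z' $ i)\<^sup>2 | z z'. z \<in> space M \<and> z' \<in> space M \<and> h i z = e \<and> h i z' = e}"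
  have le1: "\<bar>y z $ i\<bar> \<le> 1" "\<bar>w z $ i\<bar> \<le> 1" if "z \<in> space M" for z
    using y w that by (simp_all add: one_ereal_def sup_norm_le_iff)
  have bdd: "bdd_above (?A w)"
    using le1 by (intro bdd_above_square_diff)
  show "Sup0 (?A y) \<le> Sup0 (?A w)"
  proof (cases "\<forall>x\<in>?A y. x = 0")
    \<comment> \<open>This covers both a constant \<open>y\<close> on the level set and an empty
      level set, where \<open>Sup0\<close> gives 0.\<close>
    case True
    have "Sup0 (?A y) \<le> 0"
    proof (rule Sup0_le)
      fix x assume "x \<in> ?A y"
      then have "x = 0"
        by (rule bspec[OF True])
      then show "x \<le> 0"
        by (rule eq_refl)
    qed simp
    also have "0 \<le> Sup0 (?A w)"
      using bdd by (intro Sup0_nonneg) auto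
    finally show ?thesis .
  next
    case False
    then obtain z z' where "z \<in> space M" "z' \<in> space M" "h i z = e" "h i z' = e" "y z $ i \<noteq> y z' $ i"
      by auto
    then obtain x x' where x: "x \<in> space M" "x' \<in> space M" "h i x = e" "h i x' = e"
        "(w x $ i - w x' $ i)\<^sup>2 = 4"
      using split by metis
    have "Sup0 (?A y) \<le> 4"
      using le1 by (intro Sup0_le) (auto intro!: square_diff_le_4)
    also have "4 \<in> ?A w"
      unfolding mem_Collect_eq by (intro exI[of _ x] exI[of _ x'] conjI x x(5)[symmetric])
    then have "4 \<le> Sup0 (?A w)"
      using bdd by (rule Sup0_upper)
    finally show ?thesis .
  qed
qed simp

theorem theorem3p1:
  fixes M :: "'z measure"
    and \<Delta>0 :: "'n::finite \<Rightarrow> 'a set" and h0 :: "'n \<Rightarrow> 'z \<Rightarrow> 'a"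
    and \<Delta>1 :: "'n \<Rightarrow> 'b set" and h1 :: "'n \<Rightarrow> 'z \<Rightarrow> 'b"
    and \<delta> :: real
  assumes "space M \<noteq> {}"
    and "exposure_mappings M \<Delta>0 h0"
    and "exposure_mappings M \<Delta>1 h1"
    and "exposure_model M h0 \<subseteq> exposure_model M h1"
    and "\<delta> \<ge> 0"
    and "separated_alternative M \<Delta>0 h0 h1 \<delta> \<noteq> {}"
  shows "testing_impossible M (exposure_model M h0) (separated_alternative M \<Delta>0 h0 h1 \<delta>)"
proof -
  obtain y where y: "y \<in> exposure_model M h1" "\<delta> \<le> separation M \<Delta>0 h0 y"
    using assms(6) by (auto simp: separated_alternative_def)
  \<comment> \<open>\<open>r i e\<close> is a chosen point of the level set \<open>e\<close> of
    \<open>h0 i\<close>, shared by all points of that level set.\<close>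
  define r where "r i = inv_into (space M) (h0 i)" for i
  \<comment> \<open>one \<open>h1 i\<close>-class singled out inside every nonempty level set of \<open>h0 i\<close>\<close>
  define S where "S i = (\<lambda>z. h1 i (r i (h0 i z))) ` space M" for i
  define v where "v X z = sign_vec (sym_diff X {i. h1 i z \<in> S i})" for X z
  have r: "r i (h0 i z) \<in> space M" "h0 i (r i (h0 i z)) = h0 i z" if "z \<in> space M" for i z
    using that by (auto simp: r_def inv_into_into f_inv_into_f)
  \<comment> \<open>A class in \<open>S i\<close> might come from the representative of another
    level set; this is excluded because equal \<open>h1 i\<close> exposures force equal
    \<open>h0 i\<close> exposures.\<close>
  have S: "h1 i z \<in> S i \<longleftrightarrow> h1 i z = h1 i (r i (h0 i z))" if z: "z \<in> space M" for i z
  proof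
    assume "h1 i z \<in> S i"
    then obtain x where x: "x \<in> space M" "h1 i z = h1 i (r i (h0 i x))"
      by (auto simp: S_def)
    then have "h0 i z = h0 i x"
      using exposure_model_subset_imp_refines[OF assms(2,4) z r(1)] r(2) by metis
    with x show "h1 i z = h1 i (r i (h0 i z))"
      by simp
  qed (use z in \<open>auto simp: S_def\<close>)
  have v1: "v X \<in> exposure_model M h1" for X
    unfolding v_def by (rule sign_vec_in_exposure_model[OF assms(3)])
  have "separation M \<Delta>0 h0 y \<le> separation M \<Delta>0 h0 (v X)" for X
  proof (rule separation_mono)
    show "sup_norm M y \<le> 1" "sup_norm M (v X) \<le> 1"
      using y(1) v1[of X] unfolding exposure_model_def by blast+
    fix i z z'
    assume z: "z \<in> space M" "z' \<in> space M" "h0 i z = h0 i z'" "y z $ i \<noteq> y z' $ i"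
    then have "h1 i z \<noteq> h1 i z'"
      using y(1) unfolding exposure_model_def by blast
    \<comment> \<open>The exposures of \<open>z\<close> and \<open>z'\<close> under
      \<open>h1 i\<close> differ, so at least one of them differs from that of the
      representative.\<close>
    then obtain x where x: "x \<in> space M" "h0 i x = h0 i z" "h1 i x \<noteq> h1 i (r i (h0 i z))"
      using z by metis
    have "h1 i x \<notin> S i" "h1 i (r i (h0 i z)) \<in> S i"
      using x S[of x i] z(1) by (auto simp: S_def)
    \<comment> \<open>One point is inside the singled-out class and one outside, so the signs are
      opposite whatever \<open>X\<close> is.\<close>
    then have "(v X x $ i - v X (r i (h0 i z)) $ i)\<^sup>2 = 4"
      by (auto simp: v_def)
    then show "\<exists>x\<in>space M. \<exists>x'\<in>space M. h0 i x = h0 i z \<and> h0 i x' = h0 i z \<and> (v X x $ i - v X x' $ i)\<^sup>2 = 4"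
      using x(1,2) r[OF z(1)] by metis
  qed
  then have vA: "v X \<in> separated_alternative M \<Delta>0 h0 h1 \<delta>" for X
    using v1[of X] y(2) order_trans by (auto simp: separated_alternative_def)
  have u0: "(\<lambda>_. sign_vec X) \<in> exposure_model M h0" for X
    using sign_vec_in_exposure_model[OF assms(2), of X "\<lambda>_. {}"] by simp
  show ?thesis
  proof (rule testing_impossibleI)
    fix D \<phi>
    assume "D \<in> designs M" "(\<phi> :: 'z \<times> (real ^ 'n) \<Rightarrow> real) \<in> tests M"
    then show "1 \<le> testing_error (exposure_model M h0) (separated_alternative M \<Delta>0 h0 h1 \<delta>) D \<phi>"
    proof (rule testing_error_ge_1[where I = UNIV and u = "\<lambda>X _. sign_vec X" and v = v])
      show "(\<Sum>X\<in>UNIV. f (sign_vec X)) = (\<Sum>X\<in>UNIV. f (v X z))" for f :: "real ^ 'n \<Rightarrow> real" and z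
        \<comment> \<open>At fixed \<open>z\<close> the set \<open>{i. h1 i z \<in> S i}\<close>
          does not depend on \<open>X\<close> and plays the part of \<open>W\<close>.\<close>
        unfolding v_def by (rule sum_sym_diff[of "\<lambda>X. f (sign_vec X)", symmetric])
      show "exposure_model M h0 \<subseteq> borel_measurable M"
          "separated_alternative M \<Delta>0 h0 h1 \<delta> \<subseteq> borel_measurable M"
        unfolding exposure_model_def separated_alternative_def by blast+
    qed (use u0 vA in simp_all)
  qed (use assms(1,6) u0 in auto)
qed

end
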